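(* Let $c=(c_n)_{n\ge 0}$ be a given sequence, let $a=\mathcal{A}(c;\alpha)$ be the $\alpha$-aerating transform of $c$, i.e. $a=(\alpha c_0,c_1,\alpha c_1,c_2,\alpha c_2,c_3,\alpha c_3,\ldots)$, and let $g=(g_n)_{n\ge 0}$ be the Hankel transform of $a$. Then the following holds: $$g_n=\det[a_{i+j}]_{0\le i,j\le n}=\begin{cases}\det[\alpha^2c_{i+j}-c_{i+j+1}]_{0\le i,j\le k-1}\cdot\det[c_{i+j+1}]_{0\le i,j\le k-1}, & n=2k-1,\\[1mm] \alpha\cdot\det[\alpha^2c_{i+j+1}-c_{i+j+2}]_{0\le i,j\le k-1}\cdot\det[c_{i+j+1}]_{0\le i,j\le k}, & n=2k.\end{cases}$$
   Context: The Hankel transform of a sequence $a=(a_n)_{n\ge 0}$ is the sequence of Hankel determinants $\det[a_{i+j}]_{0\le i,j\le n}$, $n\ge 0$. The aerating transform of $c$ is $p=\mathcal{A}(c)$ with $p_n=c_{n/2}$ for $n$ even and $p_n=0$ for $n$ odd. For a number $\alpha$, the $\alpha$-aerating transform $a=\mathcal{A}(c;\alpha)$ is defined by $a_n=\alpha p_n+p_{n+1}$, where $p=\mathcal{A}(c)$.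
   Formalization: In the case n=2k the last factor is det[c_{i+j}]_{0≤i,j≤k} instead of the printed det[c_{i+j+1}]_{0≤i,j≤k}, since the printed formula fails already at n=0, where g_0=αc_0 and not αc_1. *)

theory Defs
  imports "Jordan_Normal_Form.Determinant"
begin

text \<open>Indices start at 0, so the \<^term>\<open>n\<close>-th term is a determinant of order \<^term>\<open>n + 1\<close>.\<close>

definition hankel_transform :: "(nat \<Rightarrow> 'a::comm_ring_1) \<Rightarrow> nat \<Rightarrow> 'a" where
  "hankel_transform a n = det (mat (n + 1) (n + 1) (\<lambda>(i, j). a (i + j)))"

definition aerating :: "(nat \<Rightarrow> 'a::zero) \<Rightarrow> nat \<Rightarrow> 'a" where
  "aerating c n = (if even n then c (n div 2) else 0)"

definition alpha_aerating :: "(nat \<Rightarrow> 'a::comm_ring_1) \<Rightarrow> 'a \<Rightarrow> nat \<Rightarrow> 'a" where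
  "alpha_aerating c \<alpha> n = \<alpha> * aerating c n + aerating c (n + 1)"

lemma alpha_aerating_even: "alpha_aerating c \<alpha> (2 * m) = \<alpha> * c m"
  by (simp add: alpha_aerating_def aerating_def)

lemma alpha_aerating_odd: "alpha_aerating c \<alpha> (2 * m + 1) = c (m + 1)"
  by (simp add: alpha_aerating_def aerating_def)

end

theory Submission
  imports Defs
begin

text \<open>Listing the even indices before the odd ones turns the Hankel matrix of \<open>a\<close> into a block
  matrix whose blocks are Hankel matrices of \<open>c\<close>. Multiplying it by a block triangular matrix of
  determinant \<open>\<alpha> ^ k\<close> makes it block triangular, which gives the claimed identity up to the
  factor \<open>\<alpha> ^ k\<close> on both sides. Over an arbitrary commutative ring this factor need not be
  cancellable, so the identity is first established over the polynomial ring, with the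
  indeterminate in the role of \<open>\<alpha>\<close>, and then evaluated.\<close>

section \<open>Reordering and block triangular determinants over a commutative ring\<close>

lemma det_permute_rows_cols:
  fixes A :: "'a::comm_ring_1 mat"
  assumes A: "A \<in> carrier_mat n n" and p: "p permutes {0..<n}"
  shows "det (mat n n (\<lambda>(i, j). A $$ (p i, p j))) = det A"
proof -
  have lt: "p i < n" if "i < n" for i
    using permutes_in_image[OF p, of i] that by simp
  \<comment> \<open>Transposing turns the column permutation into a second row permutation. The sign
    of \<open>p\<close> then occurs twice, and its square is 1.\<close>
  define B where "B = mat n n (\<lambda>(i, j). A\<^sup>T $$ (p i, j))"
  have B: "B \<in> carrier_mat n n"
    by (simp add: B_def)
  have "det (mat n n (\<lambda>(i, j). A $$ (p i, p j))) = det (mat n n (\<lambda>(i, j). B\<^sup>T $$ (p i, j)))"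
    by (rule arg_cong[where f = det], rule eq_matI) (use A lt in \<open>auto simp: B_def\<close>)
  also have "\<dots> = signof p * det B"
    using B p by (simp add: det_permute_rows det_transpose)
  also have "det B = signof p * det A"
    unfolding B_def using A p by (simp add: det_permute_rows det_transpose)
  finally show ?thesis
    by (simp add: sign_def)
qed

text \<open>Supplies the second factor of a block triangular matrix. Each induction step peels off
  the first row and column; a transposition puts the zeros below the corner entry 1, where expansion
  along the first column applies.\<close>

lemma det_four_block_mat_one_lower:
  fixes A D :: "'a::comm_ring_1 mat"
  assumes "A \<in> carrier_mat m n" "D \<in> carrier_mat m m"
  shows "det (four_block_mat (1\<^sub>m n) (0\<^sub>m n m) A D) = det D"
  using assms
proof (induction n arbitrary: A)
  case 0
  have "four_block_mat (1\<^sub>m 0) (0\<^sub>m 0 m) A D = D"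
    using 0 by (intro eq_matI) auto
  then show ?case by simp
next
  case (Suc n)
  define A' where "A' = mat m n (\<lambda>(i, j). A $$ (i, j + 1))"
  define F where "F = four_block_mat (1\<^sub>m n) (0\<^sub>m n m) A' D"
  define v where "v = mat (n + m) 1 (\<lambda>(i, j). if i < n then 0 else A $$ (i - n, 0))"
  have F: "F \<in> carrier_mat (n + m) (n + m)"
    using Suc.prems by (auto simp: F_def A'_def)
  have v: "v \<in> carrier_mat (n + m) 1" by (simp add: v_def)
  have "four_block_mat (1\<^sub>m (Suc n)) (0\<^sub>m (Suc n) m) A D = four_block_mat (1\<^sub>m 1) (0\<^sub>m 1 (n + m)) v F"
    by (rule eq_matI) (use Suc.prems in \<open>auto simp: F_def A'_def v_def not_less less_Suc_eq_0_disj\<close>)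
  also have "det \<dots> = det (four_block_mat (1\<^sub>m 1) (v\<^sup>T) (0\<^sub>m (n + m) 1) (F\<^sup>T))"
    using transpose_four_block_mat[of "1\<^sub>m 1" 1 1 "0\<^sub>m 1 (n + m)" "n + m" v "n + m" F] F v
    by (subst det_transpose[symmetric, of _ "1 + (n + m)"]) auto
  also have "\<dots> = det F"
    using F v by (subst det_four_block_mat_lower_left_zero_col[of _ _ "n + m"]) (auto simp: det_transpose)
  also have "\<dots> = det D"
    using Suc by (auto simp: F_def A'_def)
  finally show ?case .
qed

text \<open>Supplies the first factor, by peeling off the last row and column.\<close>

lemma det_four_block_mat_one_upper:
  fixes A :: "'a::comm_ring_1 mat"
  assumes "A \<in> carrier_mat n n"
  shows "det (four_block_mat A (0\<^sub>m n m) (0\<^sub>m m n) (1\<^sub>m m)) = det A"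
proof (induction m)
  case 0
  have "four_block_mat A (0\<^sub>m n 0) (0\<^sub>m 0 n) (1\<^sub>m 0) = A"
    using assms by (intro eq_matI) auto
  then show ?case by simp
next
  case (Suc m)
  define F where "F = four_block_mat A (0\<^sub>m n m) (0\<^sub>m m n) (1\<^sub>m m)"
  have F: "F \<in> carrier_mat (n + m) (n + m)"
    using assms by (auto simp: F_def)
  have "four_block_mat A (0\<^sub>m n (Suc m)) (0\<^sub>m (Suc m) n) (1\<^sub>m (Suc m)) =
      four_block_mat F (0\<^sub>m (n + m) 1) (0\<^sub>m 1 (n + m)) (1\<^sub>m 1)"
    by (rule eq_matI) (use assms in \<open>auto simp: F_def less_Suc_eq less_diff_conv2 not_less add.commute[of m n]\<close>)
  then show ?case
    using F Suc by (simp add: det_four_block_mat_upper_right_zero_col F_def[symmetric])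
qed

text \<open>The library states the block triangular formulas for integral domains only, which does not
  cover polynomials over an arbitrary commutative ring.\<close>

lemma det_four_block_mat_upper_right_zero_ring:
  fixes A :: "'a::comm_ring_1 mat"
  assumes A: "A \<in> carrier_mat n n" and C: "C \<in> carrier_mat m n" and D: "D \<in> carrier_mat m m"
  shows "det (four_block_mat A (0\<^sub>m n m) C D) = det A * det D"
proof -
  have "four_block_mat A (0\<^sub>m n m) C D =
      four_block_mat A (0\<^sub>m n m) (0\<^sub>m m n) (1\<^sub>m m) * four_block_mat (1\<^sub>m n) (0\<^sub>m n m) C D"
    using A C D by (subst mult_four_block_mat[where ?n1.0 = n and ?n2.0 = m]) auto
  also have "det \<dots> = det A * det D"
    using assms
    by (subst det_mult[of _ "n + m"]) (auto simp: det_four_block_mat_one_upper det_four_block_mat_one_lower)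
  finally show ?thesis .
qed

lemma det_four_block_mat_lower_left_zero_ring:
  fixes A :: "'a::comm_ring_1 mat"
  assumes A: "A \<in> carrier_mat n n" and B: "B \<in> carrier_mat n m" and D: "D \<in> carrier_mat m m"
  shows "det (four_block_mat A B (0\<^sub>m m n) D) = det A * det D"
proof -
  have "det (four_block_mat A B (0\<^sub>m m n) D) = det (four_block_mat (A\<^sup>T) (0\<^sub>m n m) (B\<^sup>T) (D\<^sup>T))"
    using transpose_four_block_mat[of A n n B m "0\<^sub>m m n" m D] assms
    by (subst det_transpose[symmetric, of _ "n + m"]) auto
  also have "\<dots> = det A * det D"
    using assms by (simp add: det_four_block_mat_upper_right_zero_ring det_transpose)
  finally show ?thesis .
qed

section \<open>Hankel determinants of the aerated sequence, up to the factor
  \<open>\<alpha> ^ k\<close>\<close>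

lemma det_deinterleave:
  fixes f :: "nat \<Rightarrow> nat \<Rightarrow> 'a::comm_ring_1"
  assumes e: "e = k \<or> e = k + 1"
  shows "det (mat (e + k) (e + k) (\<lambda>(i, j). f i j)) =
    det (four_block_mat (mat e e (\<lambda>(i, j). f (2 * i) (2 * j)))
                        (mat e k (\<lambda>(i, j). f (2 * i) (2 * j + 1)))
                        (mat k e (\<lambda>(i, j). f (2 * i + 1) (2 * j)))
                        (mat k k (\<lambda>(i, j). f (2 * i + 1) (2 * j + 1))))"
proof -
  \<comment> \<open>The enumeration 0, 2, 4, ..., 1, 3, 5, ..., continued by the identity so that it
    is a permutation of all natural numbers.\<close>
  define p where "p i = (if i < e then 2 * i else if i < e + k then 2 * (i - e) + 1 else i)" for i
  have inj: "inj_on p {0..<e + k}"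
    by (rule inj_onI) (auto simp: p_def split: if_splits; presburger)
  \<comment> \<open>The largest values \<open>2 * (e - 1)\<close> and \<open>2 * k - 1\<close> both
    stay below \<open>e + k\<close> because \<open>e\<close> is \<open>k\<close> or
    \<open>k + 1\<close>. An injective self-map of a finite set is bijective.\<close>
  moreover have sub: "p ` {0..<e + k} \<subseteq> {0..<e + k}"
    using e by (auto simp: p_def)
  ultimately have "bij_betw p {0..<e + k} {0..<e + k}"
    by (simp add: bij_betw_def endo_inj_surj)
  then have p: "p permutes {0..<e + k}"
    by (rule bij_imp_permutes) (auto simp: p_def)
  have lt: "p i < e + k" if "i < e + k" for i
    using subsetD[OF sub imageI[of i _ p]] that by simp
  have "det (mat (e + k) (e + k) (\<lambda>(i, j). f i j)) = det (mat (e + k) (e + k) (\<lambda>(i, j). f (p i) (p j)))"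
    by (subst det_permute_rows_cols[OF _ p, symmetric], simp)
      (rule arg_cong[where f = det], rule eq_matI, auto simp: lt)
  also have "mat (e + k) (e + k) (\<lambda>(i, j). f (p i) (p j)) =
    four_block_mat (mat e e (\<lambda>(i, j). f (2 * i) (2 * j)))
                   (mat e k (\<lambda>(i, j). f (2 * i) (2 * j + 1)))
                   (mat k e (\<lambda>(i, j). f (2 * i + 1) (2 * j)))
                   (mat k k (\<lambda>(i, j). f (2 * i + 1) (2 * j + 1)))"
    by (rule eq_matI) (auto simp: p_def)
  finally show ?thesis .
qed

lemma alpha_aerating_sum:
  "alpha_aerating c \<alpha> (2 * i + 2 * j) = \<alpha> * c (i + j)"
  "alpha_aerating c \<alpha> (2 * i + (2 * j + 1)) = c (i + j + 1)"
  "alpha_aerating c \<alpha> (2 * i + 1 + 2 * j) = c (i + j + 1)"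
  "alpha_aerating c \<alpha> (2 * i + 1 + (2 * j + 1)) = \<alpha> * c (i + j + 1)"
  using alpha_aerating_even[of c \<alpha> "i + j"] alpha_aerating_odd[of c \<alpha> "i + j"]
    alpha_aerating_even[of c \<alpha> "i + j + 1"]
  by (simp_all add: algebra_simps)

text \<open>In the original order of indices, column 2j is replaced by \<alpha> times itself minus
  column 2j+1. In row 2i+1 both terms equal \<open>\<alpha> * c (i + j + 1)\<close> and cancel; in
  row 2i the difference is the entry of \<open>E\<close>.\<close>

lemma det_hankel_alpha_aerating_even_order_cancel:
  fixes c :: "nat \<Rightarrow> 'a::comm_ring_1"
  shows "\<alpha> ^ k * det (mat (k + k) (k + k) (\<lambda>(i, j). alpha_aerating c \<alpha> (i + j))) =
    \<alpha> ^ k * (det (mat k k (\<lambda>(i, j). \<alpha>^2 * c (i + j) - c (i + j + 1)))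
           * det (mat k k (\<lambda>(i, j). c (i + j + 1))))"
proof -
  define C where "C = mat k k (\<lambda>(i, j). c (i + j))"
  define D where "D = mat k k (\<lambda>(i, j). c (i + j + 1))"
  define E where "E = mat k k (\<lambda>(i, j). \<alpha>^2 * c (i + j) - c (i + j + 1))"
  define M where "M = four_block_mat (\<alpha> \<cdot>\<^sub>m C) D D (\<alpha> \<cdot>\<^sub>m D)"
  define N where "N = four_block_mat (\<alpha> \<cdot>\<^sub>m 1\<^sub>m k) (0\<^sub>m k k) (- 1\<^sub>m k) (1\<^sub>m k)"
  note defs = C_def D_def E_def
  have C: "C \<in> carrier_mat k k" and D: "D \<in> carrier_mat k k" and E: "E \<in> carrier_mat k k"
    by (simp_all add: defs)
  have "det (mat (k + k) (k + k) (\<lambda>(i, j). alpha_aerating c \<alpha> (i + j))) = det M"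
    unfolding M_def
    by (subst det_deinterleave, simp, unfold alpha_aerating_sum)
      (rule arg_cong[where f = det], rule cong_four_block_mat; rule eq_matI; simp add: defs)
  moreover have "M * N = four_block_mat E D (0\<^sub>m k k) (\<alpha> \<cdot>\<^sub>m D)"
    unfolding M_def N_def
    by (subst mult_four_block_mat[where ?n1.0 = k and ?n2.0 = k])
      (use C D E in \<open>auto intro!: cong_four_block_mat simp: mult_smult_distrib\<close>,
       auto simp: defs algebra_simps power2_eq_square)
  moreover have "det N = \<alpha> ^ k"
    unfolding N_def by (subst det_four_block_mat_upper_right_zero_ring) auto
  moreover have "det (four_block_mat E D (0\<^sub>m k k) (\<alpha> \<cdot>\<^sub>m D)) = det E * (\<alpha> ^ k * det D)"
    using D E by (subst det_four_block_mat_lower_left_zero_ring) auto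
  moreover have "det (M * N) = det M * det N"
    using C D by (intro det_mult[of _ "k + k"]) (auto simp: M_def N_def)
  ultimately show ?thesis
    by (simp add: D_def E_def mult_ac)
qed

text \<open>With one more even index than odd ones, it is column 2j+1 that is replaced, by \<alpha>
  times itself minus column 2j+2. This clears the even rows and leaves \<open>E\<close> in the odd
  ones. The untouched block \<open>\<alpha> \<cdot>\<^sub>m C\<close> makes the last factor the
  unshifted \<open>c (i + j)\<close>: for \<open>k = 0\<close> both sides are
  \<open>\<alpha> * c 0\<close>, so a shifted \<open>c (i + j + 1)\<close> would fail in
  general.\<close>

lemma det_hankel_alpha_aerating_odd_order_cancel:
  fixes c :: "nat \<Rightarrow> 'a::comm_ring_1"
  shows "\<alpha> ^ k * det (mat (k + 1 + k) (k + 1 + k) (\<lambda>(i, j). alpha_aerating c \<alpha> (i + j))) =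
    \<alpha> ^ k * (\<alpha> * det (mat k k (\<lambda>(i, j). \<alpha>^2 * c (i + j + 1) - c (i + j + 2)))
           * det (mat (k + 1) (k + 1) (\<lambda>(i, j). c (i + j))))"
proof -
  define C where "C = mat (k + 1) (k + 1) (\<lambda>(i, j). c (i + j))"
  define B where "B = mat (k + 1) k (\<lambda>(i, j). c (i + j + 1))"
  define D where "D = mat k k (\<lambda>(i, j). c (i + j + 1))"
  define E where "E = mat k k (\<lambda>(i, j). \<alpha>^2 * c (i + j + 1) - c (i + j + 2))"
  \<comment> \<open>Right multiplication by \<open>S\<close> drops column 0 and negates the others:
    column j of the product is minus column j+1. Since the entries depend on i+j only, this raises
    every index by one.\<close>
  define S :: "'a mat" where "S = mat (k + 1) k (\<lambda>(i, j). if i = j + 1 then - 1 else 0)"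
  define M where "M = four_block_mat (\<alpha> \<cdot>\<^sub>m C) B (B\<^sup>T) (\<alpha> \<cdot>\<^sub>m D)"
  define N where "N = four_block_mat (1\<^sub>m (k + 1)) S (0\<^sub>m k (k + 1)) (\<alpha> \<cdot>\<^sub>m 1\<^sub>m k)"
  note defs = C_def B_def D_def E_def S_def
  have C: "C \<in> carrier_mat (k + 1) (k + 1)" and B: "B \<in> carrier_mat (k + 1) k"
    and D: "D \<in> carrier_mat k k" and E: "E \<in> carrier_mat k k" and S: "S \<in> carrier_mat (k + 1) k"
    by (simp_all add: defs)
  have CS: "C * S = - B"
    by (rule eq_matI) (auto simp: defs scalar_prod_def if_distrib sum.delta cong: if_cong)
  have BS: "B\<^sup>T * S = mat k k (\<lambda>(i, j). - c (i + j + 2))"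
    by (rule eq_matI) (auto simp: defs scalar_prod_def if_distrib sum.delta add_ac cong: if_cong)
  have "det (mat (k + 1 + k) (k + 1 + k) (\<lambda>(i, j). alpha_aerating c \<alpha> (i + j))) = det M"
    unfolding M_def
    by (subst det_deinterleave, simp, unfold alpha_aerating_sum)
      (rule arg_cong[where f = det], rule cong_four_block_mat; rule eq_matI; simp add: defs add_ac)
  moreover have "M * N = four_block_mat (\<alpha> \<cdot>\<^sub>m C) (0\<^sub>m (k + 1) k) (B\<^sup>T) E"
  proof -
    have 1: "\<alpha> \<cdot>\<^sub>m C * S + B * (\<alpha> \<cdot>\<^sub>m 1\<^sub>m k) = 0\<^sub>m (k + 1) k"
      unfolding mult_smult_assoc_mat[OF C S] CS using B by (intro eq_matI) (auto simp: mult_smult_distrib)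
    have 2: "B\<^sup>T * S + \<alpha> \<cdot>\<^sub>m D * (\<alpha> \<cdot>\<^sub>m 1\<^sub>m k) = E"
      unfolding BS using D by (intro eq_matI) (auto simp: mult_smult_distrib E_def D_def power2_eq_square)
    show ?thesis
      unfolding M_def N_def
      by (subst mult_four_block_mat[where ?n1.0 = "k + 1" and ?n2.0 = k])
        (use B C D S in \<open>auto simp: 1[simplified] 2\<close>)
  qed
  moreover have "det N = \<alpha> ^ k"
    unfolding N_def using S by (subst det_four_block_mat_lower_left_zero_ring) auto
  moreover have "det (four_block_mat (\<alpha> \<cdot>\<^sub>m C) (0\<^sub>m (k + 1) k) (B\<^sup>T) E) = \<alpha> ^ (k + 1) * det C * det E"
    using B C E by (subst det_four_block_mat_upper_right_zero_ring) auto
  moreover have "det (M * N) = det M * det N"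
    using B C D S by (intro det_mult[of _ "k + 1 + k"]) (auto simp: M_def N_def)
  ultimately show ?thesis
    by (simp add: C_def E_def mult_ac)
qed

section \<open>Cancelling the factor over polynomials and evaluating\<close>

text \<open>Multiplication by the indeterminate only shifts coefficients, so it is injective even
  when the coefficient ring has zero divisors.\<close>

lemma pCons_0_1_power_mult_cancel:
  fixes p q :: "'a::comm_ring_1 poly"
  assumes "[:0, 1:] ^ k * p = [:0, 1:] ^ k * q"
  shows "p = q"
  using assms by (induction k) (auto simp: mult.assoc)

text \<open>The sequence enters the generic identity as constant polynomials, so evaluation changes
  only the indeterminate.\<close>

lemma poly_alpha_aerating:
  "poly (alpha_aerating (\<lambda>n. [:c n:]) [:0, 1:] n) \<alpha> = alpha_aerating c \<alpha> n"
  by (simp add: alpha_aerating_def aerating_def)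

lemma poly_det_mat:
  "poly (det (mat n m (\<lambda>(i, j). f i j))) \<alpha> = det (mat n m (\<lambda>(i, j). poly (f i j) \<alpha>))"
proof -
  interpret comm_ring_hom "\<lambda>p. poly p \<alpha>"
    by unfold_locales auto
  show ?thesis
    unfolding hom_det[symmetric] by (rule arg_cong[where f = det], rule eq_matI) auto
qed

lemma det_hankel_alpha_aerating_even_order:
  fixes c :: "nat \<Rightarrow> 'a::comm_ring_1"
  shows "det (mat (k + k) (k + k) (\<lambda>(i, j). alpha_aerating c \<alpha> (i + j))) =
    det (mat k k (\<lambda>(i, j). \<alpha>^2 * c (i + j) - c (i + j + 1)))
    * det (mat k k (\<lambda>(i, j). c (i + j + 1)))"
  using arg_cong[where f = "\<lambda>p. poly p \<alpha>", OF pCons_0_1_power_mult_cancel[OF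
      det_hankel_alpha_aerating_even_order_cancel[of "[:0, 1:]" k "\<lambda>n. [:c n:]"]]]
  by (simp add: poly_det_mat poly_alpha_aerating mult.commute del: mult_pCons_left)

lemma det_hankel_alpha_aerating_odd_order:
  fixes c :: "nat \<Rightarrow> 'a::comm_ring_1"
  shows "det (mat (k + 1 + k) (k + 1 + k) (\<lambda>(i, j). alpha_aerating c \<alpha> (i + j))) =
    \<alpha> * det (mat k k (\<lambda>(i, j). \<alpha>^2 * c (i + j + 1) - c (i + j + 2)))
    * det (mat (k + 1) (k + 1) (\<lambda>(i, j). c (i + j)))"
  using arg_cong[where f = "\<lambda>p. poly p \<alpha>", OF pCons_0_1_power_mult_cancel[OF
      det_hankel_alpha_aerating_odd_order_cancel[of "[:0, 1:]" k "\<lambda>n. [:c n:]"]]]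
  by (simp add: poly_det_mat poly_alpha_aerating mult.commute del: mult_pCons_left)

theorem theorem6p1:
  fixes c a g :: "nat \<Rightarrow> 'a::comm_ring_1" and \<alpha> :: 'a
  assumes "a = alpha_aerating c \<alpha>"
    and "g = hankel_transform a"
  shows "\<forall>n. g n = det (mat (n + 1) (n + 1) (\<lambda>(i, j). a (i + j))) \<and>
           (\<forall>k. k \<ge> 1 \<and> n = 2 * k - 1 \<longrightarrow>
             g n = det (mat k k (\<lambda>(i, j). \<alpha>^2 * c (i + j) - c (i + j + 1)))
                 * det (mat k k (\<lambda>(i, j). c (i + j + 1)))) \<and>
           (\<forall>k. n = 2 * k \<longrightarrow>
             g n = \<alpha> * det (mat k k (\<lambda>(i, j). \<alpha>^2 * c (i + j + 1) - c (i + j + 2)))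
                 * det (mat (k + 1) (k + 1) (\<lambda>(i, j). c (i + j))))"
proof (intro allI conjI impI)
  fix n
  show g: "g n = det (mat (n + 1) (n + 1) (\<lambda>(i, j). a (i + j)))"
    by (simp add: assms hankel_transform_def)
  show "g n = det (mat k k (\<lambda>(i, j). \<alpha>^2 * c (i + j) - c (i + j + 1)))
      * det (mat k k (\<lambda>(i, j). c (i + j + 1)))" if "k \<ge> 1 \<and> n = 2 * k - 1" for k
  proof -
    \<comment> \<open>Here \<open>k \<ge> 1\<close> matters: for \<open>k = 0\<close> truncated
      subtraction gives \<open>n = 0\<close>, a determinant of order 1 instead of 0.\<close>
    have "n + 1 = k + k" using that by simp
    then show ?thesis
      unfolding g assms(1) by (simp only: det_hankel_alpha_aerating_even_order)
  qed
  show "g n = \<alpha> * det (mat k k (\<lambda>(i, j). \<alpha>^2 * c (i + j + 1) - c (i + j + 2)))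
      * det (mat (k + 1) (k + 1) (\<lambda>(i, j). c (i + j)))" if "n = 2 * k" for k
  proof -
    have "n + 1 = k + 1 + k" using that by simp
    then show ?thesis
      unfolding g assms(1) by (simp only: det_hankel_alpha_aerating_odd_order)
  qed
qed

end
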